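(* Let $E \in \mathbb{R}^{d\times n}$ be a real matrix and let $k$ be a positive integer. Consider the two optimization problems \[ \text{(I)}\qquad \min_{\alpha\in\mathbb{R}^n,\ d_0\in\mathbb{R}^d}\ \left\Vert E - d_0\,\alpha^T\right\Vert_F^2 \quad\text{s.t.}\quad \|\alpha\|_0\le k,\ \ d_0^Td_0 = 1, \] and \[ \text{(II)}\qquad \max_{w\in\mathbb{R}^n}\ w^T E^T E\, w \quad\text{s.t.}\quad w^Tw = 1,\ \ \|w\|_0 \le k . \] Then an optimum of (I) can be obtained from an optimum of (II): if $\widehat{w}$ is an optimal solution of (II) with $E\widehat{w}\neq 0$, then \[ \widehat{d}_0 = \frac{E\widehat{w}}{\|E\widehat{w}\|_2},\qquad \widehat{\alpha} = \|E\widehat{w}\|_2\,\widehat{w} \] is an optimal solution $(\widehat{\alpha},\widehat{d}_0)$ of (I).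
   Context: $\|\cdot\|_F$ denotes the Frobenius norm, $\|\cdot\|_2$ the Euclidean norm, and $\|v\|_0$ the number of nonzero entries of a vector $v$. In the paper, $E$ is the residual matrix $E_i = X - \sum_{j\neq i} d_j(\alpha^r_j)^T$ obtained from a data matrix $X$ by removing the contribution of all dictionary atoms except the $i$-th, and $\alpha$ is the (transposed) $i$-th row of the coefficient matrix; problem (II) is a sparse PCA problem. *)

theory Defs
  imports "HOL-Analysis.Analysis"
begin

text \<open>A real \<open>d \<times> n\<close> matrix has type \<^typ>\<open>real ^ 'n ^ 'd\<close>: the outer index is the row.\<close>

definition frobenius_norm :: "real ^ 'n ^ 'd \<Rightarrow> real" where
  "frobenius_norm A = sqrt (\<Sum>i\<in>UNIV. \<Sum>j\<in>UNIV. (A $ i $ j)\<^sup>2)"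

lemma frobenius_norm_eq_norm: "frobenius_norm A = norm A"
  by (simp add: frobenius_norm_def norm_vec_def L2_set_def sum_nonneg)

definition l0_norm :: "real ^ 'n \<Rightarrow> nat" where
  "l0_norm v = card {i. v $ i \<noteq> 0}"

definition outer_product :: "real ^ 'd \<Rightarrow> real ^ 'n \<Rightarrow> real ^ 'n ^ 'd" where
  "outer_product u v = (\<chi> i j. u $ i * v $ j)"

definition rank_one_objective :: "real ^ 'n ^ 'd \<Rightarrow> (real ^ 'n) \<times> (real ^ 'd) \<Rightarrow> real" where
  "rank_one_objective E = (\<lambda>(\<alpha>, d0). (frobenius_norm (E - outer_product d0 \<alpha>))\<^sup>2)"

definition rank_one_feasible :: "nat \<Rightarrow> (real ^ 'n) \<times> (real ^ 'd) \<Rightarrow> bool" where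
  "rank_one_feasible k = (\<lambda>(\<alpha>, d0). l0_norm \<alpha> \<le> k \<and> d0 \<bullet> d0 = 1)"

definition sparse_pca_objective :: "real ^ 'n ^ 'd \<Rightarrow> real ^ 'n \<Rightarrow> real" where
  "sparse_pca_objective E w = w \<bullet> ((transpose E ** E) *v w)"

definition sparse_pca_feasible :: "nat \<Rightarrow> real ^ 'n \<Rightarrow> bool" where
  "sparse_pca_feasible k w \<longleftrightarrow> w \<bullet> w = 1 \<and> l0_norm w \<le> k"

end

theory Submission
  imports Defs
begin

text \<open>
  For a unit vector \<open>d\<^sub>0\<close> the objective of (I) expands to
  \<open>\<parallel>E\<parallel>\<^sup>2 - 2 d\<^sub>0 \<bullet> E \<alpha> + \<parallel>\<alpha>\<parallel>\<^sup>2\<close>. With \<open>\<sigma> = \<parallel>E w\<parallel>\<close>, optimality of \<open>w\<close> in (II) and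
  homogeneity give \<open>\<parallel>E \<alpha>\<parallel> \<le> \<sigma> \<parallel>\<alpha>\<parallel>\<close> for every \<open>k\<close>-sparse \<open>\<alpha>\<close>. By Cauchy--Schwarz the objective is
  at least \<open>\<parallel>E\<parallel>\<^sup>2 - 2 \<sigma> \<parallel>\<alpha>\<parallel> + \<parallel>\<alpha>\<parallel>\<^sup>2 \<ge> \<parallel>E\<parallel>\<^sup>2 - \<sigma>\<^sup>2\<close>, and the proposed pair attains this bound.
\<close>

lemma l0_norm_scaleR: "c \<noteq> 0 \<Longrightarrow> l0_norm (c *\<^sub>R v) = l0_norm v"
  by (simp add: l0_norm_def)

lemma sparse_pca_objective_eq: "sparse_pca_objective E w = (norm (E *v w))\<^sup>2"
  using dot_lmul_matrix[of "E *v w" E w]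
  by (simp add: sparse_pca_objective_def power2_norm_eq_inner
      matrix_vector_mul_assoc[symmetric] transpose_matrix_vector inner_commute)

lemma inner_outer_product: "A \<bullet> outer_product u v = u \<bullet> (A *v v)"
  by (simp add: inner_vec_def outer_product_def matrix_vector_mult_def sum_distrib_left mult_ac)

lemma outer_product_mult_vector: "outer_product u v *v x = (v \<bullet> x) *\<^sub>R u"
  by (simp add: vec_eq_iff inner_vec_def outer_product_def matrix_vector_mult_def
      sum_distrib_left mult_ac)

text \<open>The last term is \<open>outer_product u a\<close> paired with itself, which the two
  lemmas above turn into \<open>u \<bullet> ((a \<bullet> a) *\<^sub>R u)\<close>.\<close>

lemma rank_one_objective_eq:
  "rank_one_objective E (a, u) = (norm E)\<^sup>2 - 2 * (u \<bullet> (E *v a)) + (u \<bullet> u) * (norm a)\<^sup>2"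
  by (simp add: rank_one_objective_def frobenius_norm_eq_norm power2_norm_eq_inner
      inner_diff_left inner_diff_right inner_outer_product outer_product_mult_vector
      matrix_vector_mult_diff_rdistrib inner_commute[of "outer_product u a" E])

lemma norm_mult_le_sparse_pca_max:
  fixes E :: "real ^ 'n ^ 'd"
  assumes w: "is_arg_max (sparse_pca_objective E) (sparse_pca_feasible k) w"
    and a: "l0_norm a \<le> k"
  shows "norm (E *v a) \<le> norm (E *v w) * norm a"
proof (cases "a = 0")
  case False
  \<comment> \<open>Rescaling to norm 1 keeps the support, so \<open>v\<close> competes with
    \<open>w\<close> in (II).\<close>
  define v where "v = (1 / norm a) *\<^sub>R a"
  have "sparse_pca_feasible k v"
    using a False
    by (simp add: sparse_pca_feasible_def v_def l0_norm_scaleR power2_norm_eq_inner[symmetric]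
        power2_eq_square)
  then have "sparse_pca_objective E v \<le> sparse_pca_objective E w"
    using w by (auto simp: is_arg_max_def not_less)
  then have "norm (E *v v) \<le> norm (E *v w)"
    by (simp add: sparse_pca_objective_eq)
  then show ?thesis
    using False by (simp add: v_def matrix_vector_mult_scaleR field_simps)
qed simp

theorem theorem1:
  fixes E :: "real ^ 'n ^ 'd" and k :: nat and w :: "real ^ 'n"
  assumes "k > 0"
    and "is_arg_max (sparse_pca_objective E) (sparse_pca_feasible k) w"
    and "E *v w \<noteq> 0"
  shows "is_arg_min (rank_one_objective E) (rank_one_feasible k)
           (norm (E *v w) *\<^sub>R w, (1 / norm (E *v w)) *\<^sub>R (E *v w))"
proof -
  define s where "s = norm (E *v w)"
  have s: "s \<noteq> 0"
    using assms(3) by (simp add: s_def)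
  have ss: "(E *v w) \<bullet> (E *v w) = s\<^sup>2"
    by (simp add: s_def power2_norm_eq_inner)
  have w: "w \<bullet> w = 1" "l0_norm w \<le> k"
    using assms(2) by (auto simp: is_arg_max_def sparse_pca_feasible_def)
  then have norm_w: "norm w = 1"
    by (simp add: norm_eq_1)
  have unit: "((1 / s) *\<^sub>R (E *v w)) \<bullet> ((1 / s) *\<^sub>R (E *v w)) = 1"
    using s by (simp add: ss power2_eq_square)
  have feasible: "rank_one_feasible k (s *\<^sub>R w, (1 / s) *\<^sub>R (E *v w))"
    unfolding rank_one_feasible_def prod.case unit using w s by (simp add: l0_norm_scaleR)
  \<comment> \<open>The cross term contributes \<open>- 2 * s\<^sup>2\<close>, the quadratic term
    \<open>s\<^sup>2\<close>.\<close>
  have attained: "rank_one_objective E (s *\<^sub>R w, (1 / s) *\<^sub>R (E *v w)) = (norm E)\<^sup>2 - s\<^sup>2"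
    unfolding rank_one_objective_eq unit
    using s by (simp add: matrix_vector_mult_scaleR ss norm_w)
  have bound: "(norm E)\<^sup>2 - s\<^sup>2 \<le> rank_one_objective E (a, u)"
    if "rank_one_feasible k (a, u)" for a u
  proof -
    have a: "l0_norm a \<le> k" and u: "u \<bullet> u = 1"
      using that by (auto simp: rank_one_feasible_def)
    have "u \<bullet> (E *v a) \<le> norm u * norm (E *v a)"
      by (rule norm_cauchy_schwarz)
    also have "\<dots> \<le> s * norm a"
      using norm_mult_le_sparse_pca_max[OF assms(2) a] u by (simp add: s_def norm_eq_sqrt_inner[of u])
    finally have "u \<bullet> (E *v a) \<le> s * norm a" .
    \<comment> \<open>Completing the square removes \<open>norm a\<close> from the lower
      bound.\<close>
    moreover have "0 \<le> (s - norm a)\<^sup>2"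
      by simp
    ultimately show ?thesis
      by (simp add: rank_one_objective_eq u power2_diff)
  qed
  show ?thesis
    unfolding s_def[symmetric] is_arg_min_def attained
    using feasible bound by (auto simp: not_less)
qed

end
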